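(* In the assertion "for all but finitely many integer pairs $(k,n)$ with $1<k<n$, $d(k,n)=\binom{n-1}{k}$", the condition $k<n$ is necessary, since $d(n,n)=1>\binom{n-1}{n}$. Also, if $$A=\left\{\frac12,\frac14,\ldots,\frac{1}{2^{n-2}},\frac{1}{3\cdot 2^{n-2}},\frac{1}{3\cdot 2^{n-3}}\right\}$$ (the $n-2$ fractions $\frac{1}{2},\ldots,\frac{1}{2^{n-2}}$ together with two further elements), then $\sum A=1$, so $d_1(A)=n$ and $d(1,n)\ge n>\binom{n-1}{1}$. Therefore the condition $1<k$ is necessary.
   Context: For a finite set $X$ of numbers, write $\sum X=\sum_{x\in X}x$. Let $A$ be a finite set of positive integers. A subset $B\subseteq A$ is a divisor of $A$ if $\sum B\mid\sum A$. The number of $k$-element subsets of $A$ that are divisors of $A$ is denoted $d_k(A)$, and $d(k,n)$ denotes the maximum value of $d_k(A)$ over all sets $A$ of $n$ positive integers. One may rescale, dividing every element of $A$ by $\sum A$, so that the elements of $A$ are positive rational numbers and $\sum A=1$; then $B\subseteq A$ is a divisor of $A$ if and only if $\sum B=\frac1m$ for some positive integer $m$, and the values $d(k,n)$ do not change. The set $A$ in the claim is given in this rescaled form. *)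

theory Defs
  imports Complex_Main
begin

definition is_divisor :: "nat set \<Rightarrow> nat set \<Rightarrow> bool" where
  "is_divisor B A \<longleftrightarrow> B \<subseteq> A \<and> \<Sum>B dvd \<Sum>A"

definition num_divisors :: "nat \<Rightarrow> nat set \<Rightarrow> nat" where
  "num_divisors k A = card {B. is_divisor B A \<and> card B = k}"

definition divisor_counts :: "nat \<Rightarrow> nat \<Rightarrow> nat set" where
  "divisor_counts k n =
     {num_divisors k A | A. finite A \<and> card A = n \<and> (\<forall>a\<in>A. 0 < a)}"

definition max_divisors :: "nat \<Rightarrow> nat \<Rightarrow> nat" where
  "max_divisors k n = Max (divisor_counts k n)"

text \<open>The maximum is taken over a finite nonempty set, so \<^const>\<open>Max\<close> is meaningful.\<close>

lemma finite_divisor_counts: "finite (divisor_counts k n)"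
proof (rule finite_subset)
  show "divisor_counts k n \<subseteq> {..2 ^ n}"
  proof
    fix c assume "c \<in> divisor_counts k n"
    then obtain A where c: "c = num_divisors k A" and A: "finite A" "card A = n"
      unfolding divisor_counts_def by blast
    have "num_divisors k A \<le> card (Pow A)"
      unfolding num_divisors_def is_divisor_def by (intro card_mono) (use A in auto)
    then show "c \<in> {..2 ^ n}" using A c by (simp add: card_Pow)
  qed
qed simp

lemma divisor_counts_nonempty: "divisor_counts k n \<noteq> {}"
proof -
  have "finite {1..n} \<and> card {1..n} = n \<and> (\<forall>a\<in>{1..n}. 0 < a)" by auto
  then show ?thesis unfolding divisor_counts_def by blast
qed

text \<open>
  Rescaled form, for sets of positive rationals with sum 1. Divisibility must be
  spelled out here: \<open>dvd\<close> on the field \<^typ>\<open>rat\<close> is trivial.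
\<close>

definition is_rescaled_divisor :: "rat set \<Rightarrow> rat set \<Rightarrow> bool" where
  "is_rescaled_divisor B A \<longleftrightarrow> B \<subseteq> A \<and> (\<exists>m::nat. 0 < m \<and> \<Sum>B = 1 / of_nat m)"

definition num_rescaled_divisors :: "nat \<Rightarrow> rat set \<Rightarrow> nat" where
  "num_rescaled_divisors k A = card {B. is_rescaled_divisor B A \<and> card B = k}"

text \<open>Only meaningful for \<open>n \<ge> 3\<close>, since the exponent \<open>n - 3\<close> is truncated below that.\<close>

definition dyadic_set :: "nat \<Rightarrow> rat set" where
  "dyadic_set n = (\<lambda>i. 1 / 2 ^ i) ` {1..n - 2} \<union> {1 / (3 * 2 ^ (n - 2)), 1 / (3 * 2 ^ (n - 3))}"

end

theory Submission
  imports Defs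
begin

text \<open>
  Multiplying the dyadic set by \<open>3 * 2 ^ (n - 2)\<close> turns it into the set of integers
  \<open>1, 2, 3, 6, 12, \<dots>, 3 * 2 ^ (n - 3)\<close>, whose sum telescopes to \<open>3 * 2 ^ (n - 2)\<close>, a multiple of
  every element. Both exceptional families \<open>(n, n)\<close> and \<open>(1, n)\<close> are infinite.
\<close>

lemma num_divisors_le_max:
  assumes "finite A" "card A = n" "\<forall>a\<in>A. 0 < a"
  shows "num_divisors k A \<le> max_divisors k n"
  unfolding max_divisors_def
  by (rule Max_ge[OF finite_divisor_counts]) (use assms in \<open>auto simp: divisor_counts_def\<close>)

lemma num_divisors_card:
  assumes "finite A"
  shows "num_divisors (card A) A = 1"
proof -
  have "{B. is_divisor B A \<and> card B = card A} = {A}"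
    using assms by (auto simp: is_divisor_def dest: card_subset_eq)
  then show ?thesis by (simp add: num_divisors_def)
qed

text \<open>The only n-element subset of an n-element set is the set itself, and its sum divides
  itself, so every admissible set contributes the same count.\<close>

lemma max_divisors_self: "max_divisors n n = 1"
proof -
  have "divisor_counts n n \<subseteq> {1}"
    by (auto simp: divisor_counts_def num_divisors_card)
  then have "divisor_counts n n = {1}"
    using divisor_counts_nonempty by blast
  then show ?thesis by (simp add: max_divisors_def)
qed

text \<open>Common form to which both the integer and the rescaled count reduce once every singleton
  is known to be a divisor.\<close>

lemma card_singletons_Collect: "card {B. (\<exists>a\<in>A. B = {a}) \<and> card B = 1} = card A"
proof -
  have "{B. (\<exists>a\<in>A. B = {a}) \<and> card B = 1} = (\<lambda>a. {a}) ` A" by auto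
  then show ?thesis by (simp add: card_image)
qed

lemma num_divisors_1:
  assumes "\<And>a. a \<in> A \<Longrightarrow> a dvd \<Sum>A"
  shows "num_divisors 1 A = card A"
proof -
  have "{B. is_divisor B A \<and> card B = 1} = {B. (\<exists>a\<in>A. B = {a}) \<and> card B = 1}"
    using assms by (auto simp: is_divisor_def card_1_singleton_iff)
  then show ?thesis by (simp only: num_divisors_def card_singletons_Collect)
qed

lemma num_rescaled_divisors_1:
  assumes "\<And>a. a \<in> A \<Longrightarrow> \<exists>m::nat. 0 < m \<and> a = 1 / of_nat m"
  shows "num_rescaled_divisors 1 A = card A"
proof -
  have "{B. is_rescaled_divisor B A \<and> card B = 1} = {B. (\<exists>a\<in>A. B = {a}) \<and> card B = 1}"
    using assms by (auto simp: is_rescaled_divisor_def card_1_singleton_iff)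
  then show ?thesis by (simp only: num_rescaled_divisors_def card_singletons_Collect)
qed

text \<open>The parameter \<open>p\<close> stands for \<open>n - 3\<close>, which avoids truncated
  subtraction in the exponents.\<close>

definition integral_dyadic_set :: "nat \<Rightarrow> nat set" where
  "integral_dyadic_set p = (\<lambda>j. 3 * 2 ^ j) ` {..p} \<union> {1, 2}"

lemma finite_integral_dyadic_set: "finite (integral_dyadic_set p)"
  by (simp add: integral_dyadic_set_def)

lemma integral_dyadic_set_pos: "a \<in> integral_dyadic_set p \<Longrightarrow> 0 < a"
  by (auto simp: integral_dyadic_set_def)

text \<open>A multiple of 3 is neither 1 nor 2. Hence the two parts of
  \<open>integral_dyadic_set p\<close> are disjoint, and cardinality and sum can be computed on each
  part.\<close>

lemma three_mult_power_two_neq: "3 * 2 ^ j \<noteq> (1::nat)" "3 * 2 ^ j \<noteq> (2::nat)"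
  by presburger+

lemma inj_three_mult_power_two: "inj_on (\<lambda>j. 3 * 2 ^ j :: nat) S"
  by (auto simp: inj_on_def)

lemma card_integral_dyadic_set: "card (integral_dyadic_set p) = p + 3"
  unfolding integral_dyadic_set_def
  by (subst card_Un_disjoint)
    (auto simp: three_mult_power_two_neq card_image[OF inj_three_mult_power_two])

lemma sum_integral_dyadic_set: "\<Sum>(integral_dyadic_set p) = 3 * 2 ^ (p + 1)"
proof -
  \<comment> \<open>The summand 3 is the contribution 1 + 2 of the two extra elements. With it the
    geometric sum doubles at each induction step.\<close>
  have "(\<Sum>j\<le>p. 3 * 2 ^ j) + 3 = (3 * 2 ^ (p + 1) :: nat)"
    by (induction p) auto
  then show ?thesis
    unfolding integral_dyadic_set_def
    by (subst sum.union_disjoint)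
      (auto simp: three_mult_power_two_neq sum.reindex[OF inj_three_mult_power_two])
qed

lemma integral_dyadic_set_dvd:
  assumes "a \<in> integral_dyadic_set p"
  shows "a dvd 3 * 2 ^ (p + 1)"
  using assms
  by (auto simp: integral_dyadic_set_def simp del: power_Suc intro!: le_imp_power_dvd)

text \<open>Scaling matches \<open>1 / 2 ^ i\<close> with \<open>3 * 2 ^ (p + 1 - i)\<close>, so the
  order of the exponents is reversed; the elements 1 and 2 give the two fractions with a factor 3 in
  the denominator.\<close>

lemma dyadic_set_eq:
  "dyadic_set (p + 3) = (\<lambda>a. of_nat a / (3 * 2 ^ (p + 1))) ` integral_dyadic_set p"
proof -
  have "{1..p + 1} = (\<lambda>j. p + 1 - j) ` {..p}"
  proof (intro equalityI subsetI)
    fix i assume "i \<in> {1..p + 1}"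
    then show "i \<in> (\<lambda>j. p + 1 - j) ` {..p}"
      by (intro image_eqI[of _ _ "p + 1 - i"]) auto
  qed auto
  then have "(\<lambda>i. 1 / 2 ^ i :: rat) ` {1..p + 1} = (\<lambda>j. 1 / 2 ^ (p + 1 - j)) ` {..p}"
    by (simp add: image_image)
  also have "\<dots> = (\<lambda>j. of_nat (3 * 2 ^ j) / (3 * 2 ^ (p + 1))) ` {..p}"
    by (intro image_cong refl) (simp add: power_diff)
  finally show ?thesis
    by (simp add: dyadic_set_def integral_dyadic_set_def image_Un image_image)
qed

lemma inj_divide_of_nat: "c \<noteq> 0 \<Longrightarrow> inj_on (\<lambda>a. of_nat a / c :: rat) S"
  by (auto simp: inj_on_def)

lemma card_dyadic_set: "card (dyadic_set (p + 3)) = p + 3"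
  unfolding dyadic_set_eq by (subst card_image[OF inj_divide_of_nat]) (simp_all add: card_integral_dyadic_set)

lemma sum_dyadic_set: "\<Sum>(dyadic_set (p + 3)) = 1"
proof -
  have "\<Sum>(dyadic_set (p + 3)) = (\<Sum>a\<in>integral_dyadic_set p. of_nat a / (3 * 2 ^ (p + 1)))"
    unfolding dyadic_set_eq by (subst sum.reindex[OF inj_divide_of_nat]) (simp_all add: o_def)
  also have "\<dots> = of_nat (\<Sum>(integral_dyadic_set p)) / (3 * 2 ^ (p + 1))"
    by (simp add: sum_divide_distrib)
  finally show ?thesis by (simp add: sum_integral_dyadic_set)
qed

lemma dyadic_set_unit_fraction:
  assumes "x \<in> dyadic_set n"
  shows "\<exists>m::nat. 0 < m \<and> x = 1 / of_nat m"
proof -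
  \<comment> \<open>The denominators are written as \<open>of_nat\<close> of a natural number so
    that the witness \<open>m\<close> can be read off.\<close>
  consider i where "x = 1 / of_nat (2 ^ i)" | i where "x = 1 / of_nat (3 * 2 ^ i)"
    using assms by (auto simp: dyadic_set_def)
  then show ?thesis
    by cases (metis zero_less_power zero_less_numeral, metis mult_pos_pos zero_less_power zero_less_numeral)
qed

text \<open>The integer form of the dyadic set is a witness: each of its elements divides the total,
  so all its singletons count.\<close>

lemma max_divisors_1_ge: "p + 3 \<le> max_divisors 1 (p + 3)"
proof -
  have "num_divisors 1 (integral_dyadic_set p) = p + 3"
    using num_divisors_1 integral_dyadic_set_dvd
    by (simp add: sum_integral_dyadic_set card_integral_dyadic_set)
  then show ?thesis
    using num_divisors_le_max[of "integral_dyadic_set p" "p + 3" 1]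
    by (simp add: finite_integral_dyadic_set card_integral_dyadic_set integral_dyadic_set_pos)
qed

theorem mainTheorem4:
  shows "(\<forall>n\<ge>1. max_divisors n n = 1 \<and> 1 > ((n - 1) choose n))
    \<and> infinite {(k, n). 1 < k \<and> k \<le> n \<and> max_divisors k n \<noteq> ((n - 1) choose k)}
    \<and> (\<forall>n\<ge>3. finite (dyadic_set n) \<and> card (dyadic_set n) = n \<and> (\<forall>a\<in>dyadic_set n. 0 < a)
          \<and> \<Sum>(dyadic_set n) = 1
          \<and> num_rescaled_divisors 1 (dyadic_set n) = n
          \<and> max_divisors 1 n \<ge> n \<and> n > ((n - 1) choose 1))
    \<and> infinite {(k, n). 1 \<le> k \<and> k < n \<and> max_divisors k n \<noteq> ((n - 1) choose k)}"
    (is "?diagonal \<and> infinite ?K \<and> ?dyadic \<and> infinite ?L")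
proof (intro conjI)
  \<comment> \<open>For \<open>n \<ge> 1\<close> the binomial coefficient is 0. At
    \<open>n = 0\<close> truncation would turn it into \<open>0 choose 0 = 1\<close>.\<close>
  show ?diagonal
    by (auto simp: max_divisors_self)
  \<comment> \<open>The shift by 2 ensures \<open>1 < k\<close>; on these pairs the maximum is 1 and
    the binomial coefficient is 0.\<close>
  have "range (\<lambda>p. (p + 2, p + 2)) \<subseteq> ?K"
    by (auto simp: max_divisors_self binomial_eq_0 simp del: binomial_Suc_Suc)
  moreover have "infinite (range (\<lambda>p::nat. (p + 2, p + 2)))"
    by (simp add: finite_image_iff inj_on_def)
  ultimately show "infinite ?K"
    by (rule infinite_super)
  show ?dyadic
  proof (intro allI impI)
    fix n :: nat assume "3 \<le> n"
    then obtain p where n: "n = p + 3"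
      using le_Suc_ex by (metis add.commute)
    have "finite (dyadic_set n)" by (simp add: dyadic_set_def)
    moreover have "\<forall>a\<in>dyadic_set n. 0 < a" by (auto simp: dyadic_set_def)
    moreover have "num_rescaled_divisors 1 (dyadic_set n) = n"
      unfolding n using num_rescaled_divisors_1 dyadic_set_unit_fraction
      by (simp only: card_dyadic_set)
    ultimately show "finite (dyadic_set n) \<and> card (dyadic_set n) = n \<and> (\<forall>a\<in>dyadic_set n. 0 < a)
          \<and> \<Sum>(dyadic_set n) = 1
          \<and> num_rescaled_divisors 1 (dyadic_set n) = n
          \<and> max_divisors 1 n \<ge> n \<and> n > ((n - 1) choose 1)"
      using card_dyadic_set sum_dyadic_set max_divisors_1_ge unfolding n by simp
  qed
  \<comment> \<open>The binomial coefficient is \<open>p + 2\<close>, one less than the lower bound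
    for the maximum.\<close>
  have "max_divisors 1 (p + 3) \<noteq> ((p + 3 - 1) choose 1)" for p
    using max_divisors_1_ge[of p] by simp
  then have "range (\<lambda>p. (1, p + 3)) \<subseteq> ?L"
    by auto
  moreover have "infinite (range (\<lambda>p::nat. (1::nat, p + 3)))"
    by (simp add: finite_image_iff inj_on_def)
  ultimately show "infinite ?L"
    by (rule infinite_super)
qed

end
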